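(* Let $k\ge1$, $m\ge1$, and let $(u_i^n)_{i\ge0}$, $1\le n\le k$, be $k$ sequences of complex numbers. Put ${\bf z}^i=[u_i^1,\dots,u_i^k]^T$, with components $z^i_p=u_i^{p+1}$, $0\le p\le k-1$, and suppose that for all $i\ge1$ $$z^i_p={}^{0}_{p}C+\sum_{j=1}^{m}\sum_{l_1,\dots,l_j=0}^{k-1}{}^{j}_{p}C_{l_1,\dots,l_j}\prod_{s=1}^{j}z^{i-1}_{l_s},\qquad 0\le p\le k-1,$$ with complex coefficients such that ${}^{j}_{p}C_{l_1,\dots,l_j}=0$ unless $l_1\le\dots\le l_j$. Define the Kronecker powers of ${\bf z}^i$ by $({\bf z}^i)^0=1$ and $({\bf z}^i)^\alpha=[u_i^1({\bf z}^i)^{\alpha-1},u_i^2({\bf z}^i)^{\alpha-1},\dots,u_i^k({\bf z}^i)^{\alpha-1}]^T$, and the infinite auxiliary vectors ${\bf y}^i=[({\bf z}^i)^0,({\bf z}^i)^1,({\bf z}^i)^2,\dots]^T$. Then the Carleman linearization of the system can be defined on the vectors ${\bf y}^i$, and the solution of the recurrence can be written as $$u_i^n={\bf e}_n\,T^i\,{\bf y}^0\qquad(1\le n\le k,\ i\ge0),$$ where ${\bf e}_n=[\delta_{0,n},\delta_{1,n},\delta_{2,n},\dots]$, ${\bf y}^0$ is determined by the initial conditions, and the infinite transition matrix is the block matrix $$T=\begin{bmatrix}1&0&0&\cdots\\ {}^{0}C&{}^{1}C&{}^{2}C&\cdots\\ {}^{0}C\otimes{}^{0}C&{}^{0}C\otimes{}^{1}C+{}^{1}C\otimes{}^{0}C&\cdots&\cdots\\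 {}^{0}C\otimes{}^{0}C\otimes{}^{0}C&\vdots&\ddots&\ddots\\ \vdots&\vdots&\ddots&\ddots\end{bmatrix},$$ whose block in block-row $\alpha\ge1$ and block-column $\beta\ge0$ is $\displaystyle\sum_{j_1+\dots+j_\alpha=\beta}{}^{j_1}C\otimes\dots\otimes{}^{j_\alpha}C$ (sum over integers $j_r\ge 0$), and whose block-row $0$ is $(1,0,0,\dots)$.
   Context: ${}^{j}C$ denotes the $k\times k^j$ matrix with rows indexed by $p\in\{0,\dots,k-1\}$, columns indexed by tuples $(l_1,\dots,l_j)\in\{0,\dots,k-1\}^j$ in lexicographic order, and entries ${}^{j}_{p}C_{l_1,\dots,l_j}$ (so ${}^0C$ is a column vector); ${}^{j}C=0$ for $j>m$. $\otimes$ is the usual Kronecker product of matrices: the rows of ${}^{j_1}C\otimes\dots\otimes{}^{j_\alpha}C$ are indexed by $(p_1,\dots,p_\alpha)$ and its columns by the concatenation of the column tuples of the factors, both in lexicographic order. Vectors and matrices are indexed from $0$; block-row (block-column) $\alpha$ has size $k^\alpha$. Thus entry $0$ of ${\bf y}^i$ is $1$ and entries $1,\dots,k$ are $u_i^1,\dots,u_i^k$. *)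

theory Defs
  imports Complex_Main "Jordan_Normal_Form.Matrix"
begin

text \<open>Rows of the product are indexed by pairs (row of \<open>A\<close>, row of \<open>B\<close>) in lexicographic order, and
  columns likewise.\<close>

definition kron :: "complex mat \<Rightarrow> complex mat \<Rightarrow> complex mat" where
  "kron A B = mat (dim_row A * dim_row B) (dim_col A * dim_col B)
     (\<lambda>(r, c). A $$ (r div dim_row B, c div dim_col B) * B $$ (r mod dim_row B, c mod dim_col B))"

primrec kron_list :: "complex mat list \<Rightarrow> complex mat" where
  "kron_list [] = 1\<^sub>m 1"
| "kron_list (A # As) = kron A (kron_list As)"

text \<open>The \<open>Suc\<close> equation stacks the vectors \<open>z $ 0 \<cdot> w\<close>, \<open>z $ 1 \<cdot> w\<close>, \<dots> on top of each other, where
  \<open>w\<close> is the preceding Kronecker power.\<close>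

primrec kron_power :: "complex vec \<Rightarrow> nat \<Rightarrow> complex vec" where
  "kron_power z 0 = vec 1 (\<lambda>_. 1)"
| "kron_power z (Suc a) =
     (let w = kron_power z a
      in vec (dim_vec z * dim_vec w) (\<lambda>r. z $ (r div dim_vec w) * w $ (r mod dim_vec w)))"

type_synonym inf_vec = "nat \<Rightarrow> complex"
type_synonym inf_mat = "nat \<Rightarrow> nat \<Rightarrow> complex"

text \<open>All products below are sums over \<open>nat\<close>; they are finite sums when the rows of the matrices
  involved have finite support.\<close>

definition row_finite :: "inf_mat \<Rightarrow> bool" where
  "row_finite A \<longleftrightarrow> (\<forall>r. finite {c. A r c \<noteq> 0})"

definition inf_mat_mult :: "inf_mat \<Rightarrow> inf_mat \<Rightarrow> inf_mat" where
  "inf_mat_mult A B = (\<lambda>r c. \<Sum>s. A r s * B s c)"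

definition inf_mat_vec :: "inf_mat \<Rightarrow> inf_vec \<Rightarrow> inf_vec" where
  "inf_mat_vec A v = (\<lambda>r. \<Sum>c. A r c * v c)"

definition inf_vec_mat :: "inf_vec \<Rightarrow> inf_mat \<Rightarrow> inf_vec" where
  "inf_vec_mat v A = (\<lambda>c. \<Sum>r. v r * A r c)"

definition inf_dot :: "inf_vec \<Rightarrow> inf_vec \<Rightarrow> complex" where
  "inf_dot v w = (\<Sum>c. v c * w c)"

primrec inf_mat_power :: "inf_mat \<Rightarrow> nat \<Rightarrow> inf_mat" where
  "inf_mat_power A 0 = (\<lambda>r c. if r = c then 1 else 0)"
| "inf_mat_power A (Suc i) = inf_mat_mult A (inf_mat_power A i)"

definition unit_row :: "nat \<Rightarrow> inf_vec" where
  "unit_row n = (\<lambda>c. if c = n then 1 else 0)"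

text \<open>The index set \<open>nat\<close> is cut into consecutive blocks, block \<open>a\<close> having size \<open>k ^ a\<close>.\<close>

definition block_start :: "nat \<Rightarrow> nat \<Rightarrow> nat" where
  "block_start k a = (\<Sum>b<a. k ^ b)"

definition block_of :: "nat \<Rightarrow> nat \<Rightarrow> nat" where
  "block_of k r = (LEAST a. r < block_start k (Suc a))"

definition block_pos :: "nat \<Rightarrow> nat \<Rightarrow> nat" where
  "block_pos k r = r - block_start k (block_of k r)"

definition from_vec_blocks :: "nat \<Rightarrow> (nat \<Rightarrow> complex vec) \<Rightarrow> inf_vec" where
  "from_vec_blocks k b = (\<lambda>r. b (block_of k r) $ block_pos k r)"

definition from_mat_blocks :: "nat \<Rightarrow> (nat \<Rightarrow> nat \<Rightarrow> complex mat) \<Rightarrow> inf_mat" where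
  "from_mat_blocks k B =
     (\<lambda>r c. B (block_of k r) (block_of k c) $$ (block_pos k r, block_pos k c))"

lemma block_of_eq:
  assumes "p < k ^ a"
  shows "block_of k (block_start k a + p) = a"
  unfolding block_of_def
proof (rule Least_equality)
  show "block_start k a + p < block_start k (Suc a)"
    using assms by (simp add: block_start_def)
next
  fix b assume *: "block_start k a + p < block_start k (Suc b)"
  show "a \<le> b"
  proof (rule ccontr)
    assume "\<not> a \<le> b"
    then have "block_start k (Suc b) \<le> block_start k a"
      unfolding block_start_def by (intro sum_mono2) auto
    with * show False by simp
  qed
qed

lemma from_mat_blocks_nth:
  assumes "p < k ^ a" "q < k ^ b"
  shows "from_mat_blocks k B (block_start k a + p) (block_start k b + q) = B a b $$ (p, q)"
  using assms by (simp add: from_mat_blocks_def block_pos_def block_of_eq)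

text \<open>The coefficient with upper index \<open>j\<close>, row \<open>p\<close> and column tuple \<open>ls\<close> is \<open>c j p ls\<close>.\<close>

definition tuples :: "nat \<Rightarrow> nat \<Rightarrow> nat list set" where
  "tuples k j = {ls. length ls = j \<and> set ls \<subseteq> {..<k}}"

text \<open>\<open>product_lists (replicate j [0..<k])\<close> enumerates the set \<open>tuples k j\<close> in lexicographic order.\<close>

definition coeff_mat :: "nat \<Rightarrow> nat \<Rightarrow> (nat \<Rightarrow> nat \<Rightarrow> nat list \<Rightarrow> complex) \<Rightarrow> nat \<Rightarrow> complex mat" where
  "coeff_mat k m c j =
     (if j \<le> m then mat k (k ^ j) (\<lambda>(p, q). c j p (product_lists (replicate j [0..<k]) ! q))
      else 0\<^sub>m k (k ^ j))"

definition carleman_block :: "nat \<Rightarrow> (nat \<Rightarrow> complex mat) \<Rightarrow> nat \<Rightarrow> nat \<Rightarrow> complex mat" where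
  "carleman_block k C a b =
     (if a = 0 then (if b = 0 then 1\<^sub>m 1 else 0\<^sub>m 1 (k ^ b))
      else mat (k ^ a) (k ^ b)
        (\<lambda>pq. \<Sum>js \<in> {js. length js = a \<and> sum_list js = b}. kron_list (map C js) $$ pq))"

definition carleman_mat :: "nat \<Rightarrow> (nat \<Rightarrow> complex mat) \<Rightarrow> inf_mat" where
  "carleman_mat k C = from_mat_blocks k (carleman_block k C)"

text \<open>The argument \<open>u n i\<close> is the \<open>i\<close>-th term of the \<open>n\<close>-th sequence, \<open>1 \<le> n \<le> k\<close>.\<close>

definition state_vec :: "nat \<Rightarrow> (nat \<Rightarrow> nat \<Rightarrow> complex) \<Rightarrow> nat \<Rightarrow> complex vec" where
  "state_vec k u i = vec k (\<lambda>p. u (p + 1) i)"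

definition carleman_vec :: "nat \<Rightarrow> (nat \<Rightarrow> nat \<Rightarrow> complex) \<Rightarrow> nat \<Rightarrow> inf_vec" where
  "carleman_vec k u i = from_vec_blocks k (kron_power (state_vec k u i))"

end

theory Submission
  imports Defs
begin

text \<open>Mixing the product rule \<open>(A \<otimes> B) (x \<otimes> y) = A x \<otimes> B y\<close> with distributivity,
  block-row \<open>a\<close> of \<open>T\<close> applied to the Kronecker powers of \<open>z\<close> gives the sum over all
  \<open>(j\<^sub>1, \<dots>, j\<^sub>a)\<close> of \<open>C\<^sub>j\<^sub>1 z\<^sup>j\<^sup>1 \<otimes> \<dots> \<otimes> C\<^sub>j\<^sub>a z\<^sup>j\<^sup>a\<close>, which is the \<open>a\<close>-th
  Kronecker power of \<open>\<Sum>\<^sub>j C\<^sub>j z\<^sup>j\<close>, the next state.  Since \<open>C\<^sub>j = 0\<close> for \<open>j > m\<close>,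
  block-row \<open>a\<close> is supported in the block-columns up to \<open>a m\<close>, so \<open>T\<close> is row-finite and its powers
  act associatively.\<close>

section \<open>Row-finite matrices\<close>

lemma inf_mat_mult_eq_sum:
  assumes "finite S" "\<And>s. s \<notin> S \<Longrightarrow> A r s = 0"
  shows "inf_mat_mult A B r c = (\<Sum>s\<in>S. A r s * B s c)"
  unfolding inf_mat_mult_def by (rule suminf_finite) (use assms in auto)

text \<open>Any finite superset \<open>S\<close> of the support is allowed, so that a single
  \<open>S\<close> can serve several rows at once.\<close>

lemma inf_mat_vec_eq_sum:
  assumes "finite S" "\<And>s. s \<notin> S \<Longrightarrow> A r s = 0"
  shows "inf_mat_vec A v r = (\<Sum>s\<in>S. A r s * v s)"
  unfolding inf_mat_vec_def by (rule suminf_finite) (use assms in auto)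

lemma row_finite_mult:
  assumes "row_finite A" "row_finite B"
  shows "row_finite (inf_mat_mult A B)"
  unfolding row_finite_def
proof
  fix r
  let ?S = "{s. A r s \<noteq> 0}"
  have fin: "finite ?S" using assms(1) by (simp add: row_finite_def)
  have "{c. inf_mat_mult A B r c \<noteq> 0} \<subseteq> (\<Union>s\<in>?S. {c. B s c \<noteq> 0})"
  proof
    fix c assume "c \<in> {c. inf_mat_mult A B r c \<noteq> 0}"
    then have "(\<Sum>s\<in>?S. A r s * B s c) \<noteq> 0"
      using inf_mat_mult_eq_sum[OF fin, of A r B c] by simp
    then obtain s where "s \<in> ?S" "A r s * B s c \<noteq> 0"
      by (meson sum.neutral)
    then show "c \<in> (\<Union>s\<in>?S. {c. B s c \<noteq> 0})" by auto
  qed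
  moreover have "finite (\<Union>s\<in>?S. {c. B s c \<noteq> 0})"
    using fin assms(2) by (simp add: row_finite_def)
  ultimately show "finite {c. inf_mat_mult A B r c \<noteq> 0}" by (rule finite_subset)
qed

lemma row_finite_power:
  assumes "row_finite A"
  shows "row_finite (inf_mat_power A i)"
proof (induction i)
  case 0
  have "{c. (if r = c then 1 else 0 :: complex) \<noteq> 0} = {r}" for r :: nat by auto
  then show ?case by (simp add: row_finite_def)
next
  case (Suc i)
  then show ?case using assms by (simp add: row_finite_mult)
qed

text \<open>The finite set \<open>?U\<close> contains the support of row \<open>r\<close> of the
  product and of every row of \<open>B\<close> that this row meets. Both sides are therefore sums
  over \<open>?S\<close> and \<open>?U\<close>, whose order can be exchanged for arbitrary
  \<open>v\<close>.\<close>

lemma inf_mat_vec_mult: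
  assumes "row_finite A" "row_finite B"
  shows "inf_mat_vec (inf_mat_mult A B) v = inf_mat_vec A (inf_mat_vec B v)"
proof
  fix r
  let ?S = "{s. A r s \<noteq> 0}"
  let ?U = "\<Union>s\<in>?S. {c. B s c \<noteq> 0}"
  have fin: "finite ?S" using assms(1) by (simp add: row_finite_def)
  have finU: "finite ?U"
    using fin assms(2) by (simp add: row_finite_def)
  have AB: "inf_mat_mult A B r c = (\<Sum>s\<in>?S. A r s * B s c)" for c
    by (rule inf_mat_mult_eq_sum[OF fin]) simp
  have "inf_mat_vec (inf_mat_mult A B) v r = (\<Sum>c\<in>?U. inf_mat_mult A B r c * v c)"
    by (rule inf_mat_vec_eq_sum[OF finU]) (auto simp: AB intro!: sum.neutral)
  also have "\<dots> = (\<Sum>s\<in>?S. \<Sum>c\<in>?U. A r s * (B s c * v c))"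
    by (subst sum.swap) (simp add: AB sum_distrib_right mult.assoc)
  also have "\<dots> = (\<Sum>s\<in>?S. A r s * inf_mat_vec B v s)"
  proof (rule sum.cong[OF refl])
    fix s assume s: "s \<in> ?S"
    have "inf_mat_vec B v s = (\<Sum>c\<in>?U. B s c * v c)"
      by (rule inf_mat_vec_eq_sum[OF finU]) (use s in auto)
    then show "(\<Sum>c\<in>?U. A r s * (B s c * v c)) = A r s * inf_mat_vec B v s"
      by (simp only: sum_distrib_left)
  qed
  also have "\<dots> = inf_mat_vec A (inf_mat_vec B v) r"
    by (rule inf_mat_vec_eq_sum[symmetric, OF fin]) simp
  finally show "inf_mat_vec (inf_mat_mult A B) v r = inf_mat_vec A (inf_mat_vec B v) r" .
qed

text \<open>\<open>inf_mat_power\<close> multiplies by \<open>A\<close> on the left, so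
  associativity peels off the outermost \<open>A\<close>, which is the last step of the
  recurrence.\<close>

lemma inf_mat_vec_power:
  assumes "row_finite A" "\<And>i. y (Suc i) = inf_mat_vec A (y i)"
  shows "inf_mat_vec (inf_mat_power A i) (y 0) = y i"
proof (induction i)
  case 0
  have "inf_mat_vec (inf_mat_power A 0) (y 0) r = y 0 r" for r
    using inf_mat_vec_eq_sum[of "{r}" "inf_mat_power A 0" r "y 0"] by simp
  then show ?case by blast
next
  case (Suc i)
  then show ?case
    by (simp add: inf_mat_vec_mult[OF assms(1) row_finite_power[OF assms(1)]] assms(2))
qed

lemma inf_dot_unit_row: "inf_dot (inf_vec_mat (unit_row n) A) v = inf_mat_vec A v n"
proof -
  have "inf_vec_mat (unit_row n) A c = A n c" for c
    unfolding inf_vec_mat_def by (subst suminf_finite[of "{n}"]) (auto simp: unit_row_def)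
  then show ?thesis by (simp add: inf_dot_def inf_mat_vec_def)
qed

section \<open>The block decomposition of the index set\<close>

lemma block_start_Suc: "block_start k (Suc a) = block_start k a + k ^ a"
  by (simp add: block_start_def)

text \<open>Since \<open>k \<ge> 1\<close>, no block is empty, so the successor of the last index of
  a block is position 0 of the next block.\<close>

lemma block_decomp:
  assumes "k \<ge> 1"
  obtains a p where "p < k ^ a" "r = block_start k a + p"
proof -
  have "\<exists>a p. p < k ^ a \<and> r = block_start k a + p"
  proof (induction r)
    case 0
    have "(0::nat) < k ^ 0 \<and> 0 = block_start k 0 + 0" by (simp add: block_start_def)
    then show ?case by blast
  next
    case (Suc r)
    then obtain a p where p: "p < k ^ a" "r = block_start k a + p" by blast
    show ?case
    proof (cases "Suc p < k ^ a")
      case True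
      then show ?thesis using p by (metis add_Suc_right)
    next
      case False
      then have "Suc r = block_start k (Suc a) + 0" using p by (simp add: block_start_Suc)
      moreover have "0 < k ^ Suc a" using assms by simp
      ultimately show ?thesis by blast
    qed
  qed
  then show thesis using that by blast
qed

lemma block_start_mono: "a \<le> b \<Longrightarrow> block_start k a \<le> block_start k b"
  unfolding block_start_def by (intro sum_mono2) auto

lemma sum_lessThan_add:
  fixes f :: "nat \<Rightarrow> 'a::comm_monoid_add"
  shows "sum f {..<a + b} = sum f {..<a} + (\<Sum>q<b. f (a + q))"
  by (induction b) (auto simp: add.assoc)

lemma sum_blocks:
  fixes f :: "nat \<Rightarrow> 'a::comm_monoid_add"
  shows "sum f {..<block_start k n} = (\<Sum>b<n. \<Sum>q<k ^ b. f (block_start k b + q))"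
proof (induction n)
  case 0
  show ?case by (simp add: block_start_def)
next
  case (Suc n)
  then show ?case by (simp add: block_start_Suc sum_lessThan_add)
qed

lemma from_vec_blocks_nth:
  assumes "p < k ^ a"
  shows "from_vec_blocks k b (block_start k a + p) = b a $ p"
  using assms by (simp add: from_vec_blocks_def block_pos_def block_of_eq)

section \<open>Kronecker products\<close>

text \<open>A flat index below \<open>a * b\<close> encodes a pair in lexicographic order; the
  induction on \<open>a\<close> splits off the last run of \<open>b\<close> indices.\<close>

lemma sum_div_mod:
  fixes f :: "nat \<Rightarrow> nat \<Rightarrow> 'a::comm_monoid_add"
  shows "(\<Sum>q<a * b. f (q div b) (q mod b)) = (\<Sum>x<a. \<Sum>y<b. f x y)"
proof (cases "b = 0")
  case False
  then show ?thesis
    by (induction a) (simp_all add: sum_lessThan_add[of _ "_ * _"] add.commute[of b])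
qed simp

lemma dim_kron_power: "dim_vec (kron_power z a) = dim_vec z ^ a"
  by (induction a) (auto simp: Let_def)

lemma div_less_of_mult: "q < a * b \<Longrightarrow> q div b < a" for q a b :: nat
  by (simp add: less_mult_imp_div_less)

lemma mod_less_of_mult: "q < a * b \<Longrightarrow> q mod b < b" for q a b :: nat
  by (metis mod_less_divisor mult_0_right not_less_zero zero_less_iff_neq_zero)

text \<open>In mixed radix, with lowest digit in base \<open>b\<close> and the next in base
  \<open>a\<close>, both sides are the second digit of \<open>q\<close>.\<close>

lemma mod_mult_div: "q mod (a * b) div b = q div b mod a" for q a b :: nat
  by (cases "b = 0") (simp_all add: mult.commute[of a] mod_mult2_eq)

lemma kron_power_Suc_nth:
  assumes "q < dim_vec z ^ Suc a"
  shows "kron_power z (Suc a) $ q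
    = z $ (q div dim_vec z ^ a) * kron_power z a $ (q mod dim_vec z ^ a)"
  using assms by (simp add: Let_def dim_kron_power)

text \<open>The definition splits off only one leading factor. A matrix \<open>C j\<close> acts on
  \<open>j\<close> factors at once, which requires splitting at an arbitrary place.\<close>

lemma kron_power_add_nth:
  assumes "q < dim_vec z ^ (a + b)"
  shows "kron_power z (a + b) $ q
    = kron_power z a $ (q div dim_vec z ^ b) * kron_power z b $ (q mod dim_vec z ^ b)"
  using assms
proof (induction a arbitrary: q)
  case 0
  then show ?case by simp
next
  case (Suc a)
  let ?k = "dim_vec z"
  have q: "q < ?k ^ Suc a * ?k ^ b" "q < ?k * ?k ^ (a + b)"
    using Suc.prems by (simp_all add: power_add mult.assoc)
  have r: "q mod ?k ^ (a + b) < ?k ^ (a + b)" by (rule mod_less_of_mult[OF q(2)])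
  \<comment> \<open>The index \<open>q\<close> has three digits, in bases \<open>?k\<close>,
    \<open>?k ^ a\<close> and \<open>?k ^ b\<close>. Facts 1 to 3 say that the two orders of
    splitting yield the same digits.\<close>
  have 1: "q mod ?k ^ (a + b) div ?k ^ b = q div ?k ^ b mod ?k ^ a"
    by (simp only: power_add mod_mult_div)
  have 2: "q mod ?k ^ (a + b) mod ?k ^ b = q mod ?k ^ b"
    by (simp add: mod_mod_cancel le_imp_power_dvd)
  have 3: "q div ?k ^ (a + b) = q div ?k ^ b div ?k ^ a"
    by (simp add: div_mult2_eq[symmetric] power_add mult.commute)
  have "kron_power z (Suc a + b) $ q
      = z $ (q div ?k ^ (a + b)) * kron_power z (a + b) $ (q mod ?k ^ (a + b))"
    using kron_power_Suc_nth[of q z "a + b"] Suc.prems by simp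
  also have "\<dots> = z $ (q div ?k ^ b div ?k ^ a)
      * (kron_power z a $ (q div ?k ^ b mod ?k ^ a) * kron_power z b $ (q mod ?k ^ b))"
    by (simp only: Suc.IH[OF r] 1 2 3)
  also have "\<dots> = kron_power z (Suc a) $ (q div ?k ^ b) * kron_power z b $ (q mod ?k ^ b)"
    using kron_power_Suc_nth[OF div_less_of_mult[OF q(1)]] by (simp only: mult.assoc)
  finally show ?case .
qed

lemma kron_list_carrier:
  assumes "\<And>j. C j \<in> carrier_mat k (k ^ j)"
  shows "kron_list (map C js) \<in> carrier_mat (k ^ length js) (k ^ sum_list js)"
proof (induction js)
  case (Cons j js)
  then show ?case using assms[of j] by (auto simp: kron_def power_add)
qed simp

lemma kron_list_Cons_nth:
  assumes C: "\<And>j. C j \<in> carrier_mat k (k ^ j)"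
    and "p < k ^ length (j # js)" "q < k ^ sum_list (j # js)"
  shows "kron_list (map C (j # js)) $$ (p, q)
    = C j $$ (p div k ^ length js, q div k ^ sum_list js)
      * kron_list (map C js) $$ (p mod k ^ length js, q mod k ^ sum_list js)"
  using assms(2,3) kron_list_carrier[OF C, where js=js] C[of j]
  by (auto simp: kron_def power_add)

text \<open>One zero factor annihilates a Kronecker product; the induction walks along
  \<open>js\<close> to an index above \<open>m\<close>.\<close>

lemma kron_list_eq_0:
  assumes C: "\<And>j. C j \<in> carrier_mat k (k ^ j)"
    and zero: "\<forall>j>m. C j = 0\<^sub>m k (k ^ j)"
    and "\<not> set js \<subseteq> {..m}" "p < k ^ length js" "q < k ^ sum_list js"
  shows "kron_list (map C js) $$ (p, q) = 0"
  using assms(3-)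
proof (induction js arbitrary: p q)
  case (Cons j js)
  note bounds = Cons.prems(2,3)
  have p: "p < k * k ^ length js" and q: "q < k ^ j * k ^ sum_list js"
    using bounds by (simp_all add: power_add)
  show ?case
  proof (cases "j > m")
    case True
    then show ?thesis
      unfolding kron_list_Cons_nth[OF C bounds]
      using div_less_of_mult[OF p] div_less_of_mult[OF q] zero True by simp
  next
    case False
    then have "\<not> set js \<subseteq> {..m}" using Cons.prems(1) by auto
    then show ?thesis
      unfolding kron_list_Cons_nth[OF C bounds]
      using Cons.IH[OF _ mod_less_of_mult[OF p] mod_less_of_mult[OF q]] by simp
  qed
qed simp

text \<open>For \<open>js = [j\<^sub>1, \<dots>, j\<^sub>a]\<close> this is one summand of the
  expansion: entry \<open>p\<close> of \<open>C\<^sub>j\<^sub>1 \<otimes> \<dots> \<otimes>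
  C\<^sub>j\<^sub>a\<close> applied to the Kronecker power of matching length.\<close>

definition kron_image :: "(nat \<Rightarrow> complex mat) \<Rightarrow> complex vec \<Rightarrow> nat list \<Rightarrow> nat \<Rightarrow> complex" where
  "kron_image C z js p
    = (\<Sum>q<dim_vec z ^ sum_list js. kron_list (map C js) $$ (p, q) * kron_power z (sum_list js) $ q)"

lemma kron_image_Nil: "kron_image C z [] 0 = 1"
  by (simp add: kron_image_def)

text \<open>This is the mixed product rule. Each summand is a function of the high digit of
  \<open>q\<close> times a function of its low digit, so the sum over \<open>q\<close>
  factors.\<close>

lemma kron_image_Cons:
  assumes C: "\<And>j. C j \<in> carrier_mat (dim_vec z) (dim_vec z ^ j)"
    and p: "p < dim_vec z ^ length (j # js)"
  shows "kron_image C z (j # js) p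
    = (\<Sum>q<dim_vec z ^ j. C j $$ (p div dim_vec z ^ length js, q) * kron_power z j $ q)
      * kron_image C z js (p mod dim_vec z ^ length js)"
proof -
  let ?k = "dim_vec z" and ?s = "sum_list js"
  let ?p = "p div ?k ^ length js" and ?p' = "p mod ?k ^ length js"
  have "kron_image C z (j # js) p = (\<Sum>q<?k ^ j * ?k ^ ?s.
      (C j $$ (?p, q div ?k ^ ?s) * kron_power z j $ (q div ?k ^ ?s))
      * (kron_list (map C js) $$ (?p', q mod ?k ^ ?s) * kron_power z ?s $ (q mod ?k ^ ?s)))"
    unfolding kron_image_def
  proof (rule sum.cong)
    fix q assume "q \<in> {..<?k ^ j * ?k ^ ?s}"
    then have q: "q < ?k ^ (j + ?s)" by (simp add: power_add)
    then have q': "q < ?k ^ sum_list (j # js)" by simp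
    show "kron_list (map C (j # js)) $$ (p, q) * kron_power z (sum_list (j # js)) $ q
      = (C j $$ (?p, q div ?k ^ ?s) * kron_power z j $ (q div ?k ^ ?s))
      * (kron_list (map C js) $$ (?p', q mod ?k ^ ?s) * kron_power z ?s $ (q mod ?k ^ ?s))"
      unfolding kron_list_Cons_nth[OF C p q'] sum_list.Cons kron_power_add_nth[OF q]
      by (simp only: mult_ac)
  qed (simp add: power_add)
  also have "\<dots> = (\<Sum>x<?k ^ j. \<Sum>y<?k ^ ?s. (C j $$ (?p, x) * kron_power z j $ x)
      * (kron_list (map C js) $$ (?p', y) * kron_power z ?s $ y))"
    by (rule sum_div_mod)
  also have "\<dots> = (\<Sum>x<?k ^ j. C j $$ (?p, x) * kron_power z j $ x) * kron_image C z js ?p'"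
    by (simp only: kron_image_def sum_product)
  finally show ?thesis .
qed

lemma lists_Suc_eq:
  "{js. length js = Suc a \<and> set js \<subseteq> A} = (\<lambda>(j, js). j # js) ` (A \<times> {js. length js = a \<and> set js \<subseteq> A})"
  by (auto simp: length_Suc_conv image_iff)

lemma sum_lists_Suc:
  "(\<Sum>js\<in>{js. length js = Suc a \<and> set js \<subseteq> A}. f js)
    = (\<Sum>j\<in>A. \<Sum>js\<in>{js. length js = a \<and> set js \<subseteq> A}. f (j # js))"
  unfolding lists_Suc_eq
  by (subst sum.reindex) (auto simp: inj_on_def sum.cartesian_product split_def)

text \<open>Distributivity: expanding the \<open>a\<close>-fold Kronecker power of the sum
  \<open>w\<close> means choosing one index \<open>j \<le> m\<close> per factor, and
  \<open>js\<close> records the choices.\<close>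

lemma sum_kron_image:
  assumes C: "\<And>j. C j \<in> carrier_mat (dim_vec z) (dim_vec z ^ j)"
    and w: "dim_vec w = dim_vec z"
      "\<And>p. p < dim_vec z \<Longrightarrow> w $ p = (\<Sum>j\<le>m. \<Sum>q<dim_vec z ^ j. C j $$ (p, q) * kron_power z j $ q)"
    and "p < dim_vec z ^ a"
  shows "(\<Sum>js\<in>{js. length js = a \<and> set js \<subseteq> {..m}}. kron_image C z js p) = kron_power w a $ p"
  using assms(4)
proof (induction a arbitrary: p)
  case 0
  have "{js. length js = 0 \<and> set js \<subseteq> {..m}} = {[]}" by auto
  then show ?case using 0 by (simp add: kron_image_Nil)
next
  case (Suc a)
  let ?k = "dim_vec z"
  let ?L = "{js. length js = a \<and> set js \<subseteq> {..m}}"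
  let ?g = "\<lambda>j. \<Sum>q<?k ^ j. C j $$ (p div ?k ^ a, q) * kron_power z j $ q"
  have p: "p < ?k * ?k ^ a" using Suc.prems by simp
  have "(\<Sum>js\<in>{js. length js = Suc a \<and> set js \<subseteq> {..m}}. kron_image C z js p)
      = (\<Sum>j\<le>m. \<Sum>js\<in>?L. ?g j * kron_image C z js (p mod ?k ^ a))"
    unfolding sum_lists_Suc
    by (intro sum.cong refl) (use kron_image_Cons[OF C] Suc.prems in auto)
  also have "\<dots> = (\<Sum>j\<le>m. ?g j) * (\<Sum>js\<in>?L. kron_image C z js (p mod ?k ^ a))"
    by (simp only: sum_product)
  also have "\<dots> = w $ (p div ?k ^ a) * kron_power w a $ (p mod ?k ^ a)"
    by (simp only: Suc.IH[OF mod_less_of_mult[OF p]] w(2)[OF div_less_of_mult[OF p]])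
  also have "\<dots> = kron_power w (Suc a) $ p"
    using kron_power_Suc_nth[of p w a] Suc.prems by (simp only: w(1))
  finally show ?case .
qed

section \<open>The Carleman matrix\<close>

lemma finite_lists_sum: "finite {js :: nat list. length js = a \<and> sum_list js = b}"
proof (rule finite_subset)
  show "{js. length js = a \<and> sum_list js = b} \<subseteq> {js. set js \<subseteq> {..b} \<and> length js = a}"
    using member_le_sum_list by auto
qed (simp add: finite_lists_length_eq)

text \<open>Block-row \<open>0\<close> is no exception: only the empty list contributes to it, and \<open>kron_list []\<close> is
  the \<open>1 \<times> 1\<close> identity.\<close>

lemma carleman_block_nth:
  assumes "p < k ^ a" "q < k ^ b"
  shows "carleman_block k C a b $$ (p, q)
    = (\<Sum>js\<in>{js. length js = a \<and> sum_list js = b}. kron_list (map C js) $$ (p, q))"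
proof (cases "a = 0")
  case True
  have "{js. length js = 0 \<and> sum_list js = b} = (if b = 0 then {[]} else {})" by auto
  then show ?thesis using True assms by (simp add: carleman_block_def)
qed (use assms in \<open>simp add: carleman_block_def\<close>)

lemma sum_list_le_length_mult: "set js \<subseteq> {..m} \<Longrightarrow> sum_list js \<le> length js * m" for js :: "nat list"
  by (induction js) auto

text \<open>Lists with an entry above \<open>m\<close> contribute 0. The remaining ones form a slice
  of a finite set independent of \<open>b\<close>, so the slices can later be reassembled over all
  \<open>b\<close>.\<close>

lemma carleman_block_nth_bounded:
  assumes C: "\<And>j. C j \<in> carrier_mat k (k ^ j)"
    and zero: "\<forall>j>m. C j = 0\<^sub>m k (k ^ j)"
    and "p < k ^ a" "q < k ^ b"
  shows "carleman_block k C a b $$ (p, q)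
    = (\<Sum>js\<in>{js \<in> {js. length js = a \<and> set js \<subseteq> {..m}}. sum_list js = b}.
        kron_list (map C js) $$ (p, q))"
  unfolding carleman_block_nth[OF assms(3,4)]
proof (rule sum.mono_neutral_right[OF finite_lists_sum], blast, rule ballI)
  fix js
  assume "js \<in> {js. length js = a \<and> sum_list js = b}
    - {js \<in> {js. length js = a \<and> set js \<subseteq> {..m}}. sum_list js = b}"
  then have "\<not> set js \<subseteq> {..m}" "p < k ^ length js" "q < k ^ sum_list js"
    using assms(3,4) by auto
  then show "kron_list (map C js) $$ (p, q) = 0"
    by (rule kron_list_eq_0[OF C zero])
qed

text \<open>\<open>block_start k (Suc (a * m))\<close> is the first index after block
  \<open>a * m\<close>; a list of length \<open>a\<close> with entries at most \<open>m\<close> has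
  sum at most \<open>a * m\<close>, so later blocks receive no summand.\<close>

lemma carleman_mat_eq_0:
  assumes "k \<ge> 1"
    and C: "\<And>j. C j \<in> carrier_mat k (k ^ j)"
    and zero: "\<forall>j>m. C j = 0\<^sub>m k (k ^ j)"
    and p: "p < k ^ a"
    and c: "c \<notin> {..<block_start k (Suc (a * m))}"
  shows "carleman_mat k C (block_start k a + p) c = 0"
proof -
  obtain b q where q: "q < k ^ b" "c = block_start k b + q"
    using block_decomp[OF assms(1)] by blast
  have "b > a * m"
  proof (rule ccontr)
    assume "\<not> b > a * m"
    then have "block_start k (Suc b) \<le> block_start k (Suc (a * m))"
      by (intro block_start_mono) simp
    then show False using c q by (simp add: block_start_Suc)
  qed
  then have empty: "{js \<in> {js. length js = a \<and> set js \<subseteq> {..m}}. sum_list js = b} = {}"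
    using sum_list_le_length_mult by (auto simp: not_less[symmetric])
  show ?thesis
    unfolding carleman_mat_def q(2) from_mat_blocks_nth[OF p q(1)]
      carleman_block_nth_bounded[OF C zero p q(1)] empty by simp
qed

lemma row_finite_carleman_mat:
  assumes "k \<ge> 1"
    and C: "\<And>j. C j \<in> carrier_mat k (k ^ j)"
    and zero: "\<forall>j>m. C j = 0\<^sub>m k (k ^ j)"
  shows "row_finite (carleman_mat k C)"
  unfolding row_finite_def
proof
  fix r
  obtain a p where p: "p < k ^ a" "r = block_start k a + p"
    using block_decomp[OF assms(1)] by blast
  have "{c. carleman_mat k C r c \<noteq> 0} \<subseteq> {..<block_start k (Suc (a * m))}"
    using carleman_mat_eq_0[OF assms(1) C zero p(1)] p(2) by blast
  then show "finite {c. carleman_mat k C r c \<noteq> 0}"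
    by (rule finite_subset) simp
qed

lemma carleman_mat_kron_powers:
  assumes "dim_vec z \<ge> 1"
    and C: "\<And>j. C j \<in> carrier_mat (dim_vec z) (dim_vec z ^ j)"
    and zero: "\<forall>j>m. C j = 0\<^sub>m (dim_vec z) (dim_vec z ^ j)"
    and w: "dim_vec w = dim_vec z"
      "\<And>p. p < dim_vec z \<Longrightarrow> w $ p = (\<Sum>j\<le>m. \<Sum>q<dim_vec z ^ j. C j $$ (p, q) * kron_power z j $ q)"
  shows "inf_mat_vec (carleman_mat (dim_vec z) C) (from_vec_blocks (dim_vec z) (kron_power z))
    = from_vec_blocks (dim_vec z) (kron_power w)"
proof
  fix r
  let ?k = "dim_vec z"
  obtain a p where p: "p < ?k ^ a" and r: "r = block_start ?k a + p"
    using block_decomp[OF assms(1)] by blast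
  let ?L = "{js. length js = a \<and> set js \<subseteq> {..m}}"
  have finL: "finite ?L"
    using finite_lists_length_eq[of "{..m}" a] by (simp add: conj_commute)
  have "inf_mat_vec (carleman_mat ?k C) (from_vec_blocks ?k (kron_power z)) r
      = (\<Sum>c<block_start ?k (Suc (a * m)). carleman_mat ?k C r c * from_vec_blocks ?k (kron_power z) c)"
    unfolding r by (rule inf_mat_vec_eq_sum) (auto intro!: carleman_mat_eq_0[OF assms(1) C zero p])
  also have "\<dots> = (\<Sum>b<Suc (a * m). \<Sum>q<?k ^ b. carleman_block ?k C a b $$ (p, q) * kron_power z b $ q)"
    unfolding sum_blocks r
    by (intro sum.cong refl)
      (simp add: carleman_mat_def from_mat_blocks_nth[OF p] from_vec_blocks_nth)
  also have "\<dots> = (\<Sum>b<Suc (a * m). \<Sum>js\<in>{js \<in> ?L. sum_list js = b}. kron_image C z js p)"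
  proof (intro sum.cong refl)
    fix b
    let ?Lb = "{js \<in> ?L. sum_list js = b}"
    have "(\<Sum>q<?k ^ b. carleman_block ?k C a b $$ (p, q) * kron_power z b $ q)
        = (\<Sum>q<?k ^ b. \<Sum>js\<in>?Lb. kron_list (map C js) $$ (p, q) * kron_power z b $ q)"
      by (intro sum.cong refl)
        (simp only: lessThan_iff carleman_block_nth_bounded[OF C zero p] sum_distrib_right)
    also have "\<dots> = (\<Sum>js\<in>?Lb. \<Sum>q<?k ^ b. kron_list (map C js) $$ (p, q) * kron_power z b $ q)"
      by (rule sum.swap)
    also have "\<dots> = (\<Sum>js\<in>?Lb. kron_image C z js p)"
      by (rule sum.cong) (auto simp: kron_image_def)
    finally show "(\<Sum>q<?k ^ b. carleman_block ?k C a b $$ (p, q) * kron_power z b $ q)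
        = (\<Sum>js\<in>?Lb. kron_image C z js p)" .
  qed
  \<comment> \<open>The sum of every list in \<open>?L\<close> lies in the range of
    \<open>b\<close>, so grouping by sum loses no list.\<close>
  also have "\<dots> = (\<Sum>js\<in>?L. kron_image C z js p)"
  proof (rule sum.group)
    show "sum_list ` ?L \<subseteq> {..<Suc (a * m)}"
      using sum_list_le_length_mult by (fastforce simp: less_Suc_eq_le)
  qed (use finL in auto)
  also have "\<dots> = kron_power w a $ p"
    by (rule sum_kron_image[OF C w p])
  also have "\<dots> = from_vec_blocks ?k (kron_power w) r"
    by (simp only: r from_vec_blocks_nth[OF p])
  finally show "inf_mat_vec (carleman_mat ?k C) (from_vec_blocks ?k (kron_power z)) r
      = from_vec_blocks ?k (kron_power w) r" .
qed

section \<open>Tuples in lexicographic order\<close>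

text \<open>Equal lengths make positions in the concatenation split by div and mod, as Kronecker
  indices do.\<close>

lemma nth_concat_map_uniform:
  assumes "\<And>x. x \<in> set xs \<Longrightarrow> length (f x) = n" "q < length xs * n"
  shows "concat (map f xs) ! q = f (xs ! (q div n)) ! (q mod n)"
  using assms
proof (induction xs arbitrary: q)
  case (Cons x xs)
  have n: "n > 0" using Cons.prems(2) by (cases n) auto
  show ?case
  proof (cases "q < n")
    case True
    then show ?thesis using Cons.prems(1) by (simp add: nth_append)
  next
    case False
    have "q div n = Suc ((q - n) div n)" "q mod n = (q - n) mod n"
      using False n by (simp_all add: le_div_geq le_mod_geq)
    moreover have "q - n < length xs * n" using Cons.prems(2) False by auto
    ultimately show ?thesis
      using False Cons.prems(1) Cons.IH[of "q - n"] by (simp add: nth_append)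
  qed
qed simp

abbreviation lex_tuples :: "nat \<Rightarrow> nat \<Rightarrow> nat list list" where
  "lex_tuples k j \<equiv> product_lists (replicate j [0..<k])"

lemma length_lex_tuples: "length (lex_tuples k j) = k ^ j"
  by (induction j) (auto simp: length_concat comp_def sum_list_triv)

lemma lex_tuples_Suc_nth:
  assumes "q < k ^ Suc j"
  shows "lex_tuples k (Suc j) ! q = (q div k ^ j) # lex_tuples k j ! (q mod k ^ j)"
proof -
  have q: "q < k * k ^ j" using assms by simp
  have "lex_tuples k (Suc j) ! q
      = map (Cons ([0..<k] ! (q div k ^ j))) (lex_tuples k j) ! (q mod k ^ j)"
    using nth_concat_map_uniform[of "[0..<k]" "\<lambda>x. map (Cons x) (lex_tuples k j)" "k ^ j" q] q
    by (simp add: length_lex_tuples)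
  then show ?thesis
    using div_less_of_mult[OF q] mod_less_of_mult[OF q] by (simp add: length_lex_tuples)
qed

lemma set_lex_tuples: "set (lex_tuples k j) = tuples k j"
  by (force simp: product_lists_set tuples_def list_all2_conv_all_nth in_set_conv_nth subset_iff)

lemma distinct_lex_tuples: "distinct (lex_tuples k j)"
  by (rule distinct_product_lists) auto

text \<open>The tuple at position \<open>q\<close> consists of the base-\<open>k\<close> digits of
  \<open>q\<close>, leading digit first, where \<open>k = dim_vec z\<close>. The Kronecker power
  peels off the same digit, so its entry is the monomial named by that tuple.\<close>

lemma kron_power_nth_prod:
  assumes "q < dim_vec z ^ j"
  shows "kron_power z j $ q = (\<Prod>s<j. z $ (lex_tuples (dim_vec z) j ! q ! s))"
  using assms
proof (induction j arbitrary: q)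
  case (Suc j)
  let ?k = "dim_vec z"
  have "q mod ?k ^ j < ?k ^ j" using Suc.prems by (intro mod_less_of_mult[of _ ?k]) simp
  from Suc.IH[OF this] show ?case
    unfolding kron_power_Suc_nth[OF Suc.prems] lex_tuples_Suc_nth[OF Suc.prems]
      prod.lessThan_Suc_shift by simp
qed simp

lemma sum_tuples_eq:
  "(\<Sum>ls\<in>tuples k j. f ls) = (\<Sum>q<k ^ j. f (lex_tuples k j ! q))"
proof -
  have "bij_betw ((!) (lex_tuples k j)) {..<k ^ j} (tuples k j)"
    by (rule bij_betw_nth) (simp_all add: distinct_lex_tuples length_lex_tuples set_lex_tuples)
  then show ?thesis by (simp only: sum.reindex_bij_betw)
qed

text \<open>This identifies the matrix-vector product with the degree-\<open>j\<close> part of the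
  recurrence.\<close>

lemma coeff_mat_kron_power:
  assumes "j \<le> m" "p < dim_vec z"
  shows "(\<Sum>q<dim_vec z ^ j. coeff_mat (dim_vec z) m c j $$ (p, q) * kron_power z j $ q)
    = (\<Sum>ls\<in>tuples (dim_vec z) j. c j p ls * (\<Prod>s<j. z $ (ls ! s)))"
  unfolding sum_tuples_eq
  by (intro sum.cong refl) (use assms in \<open>simp add: coeff_mat_def kron_power_nth_prod\<close>)

text \<open>The row-finiteness conjuncts ensure that every infinite sum in the other two conjuncts
  is a finite sum, not a default value of a divergent series.\<close>

theorem theorem3p1:
  fixes k m :: nat
    and u :: "nat \<Rightarrow> nat \<Rightarrow> complex"
    and c :: "nat \<Rightarrow> nat \<Rightarrow> nat list \<Rightarrow> complex"
  assumes "k \<ge> 1" and "m \<ge> 1"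
    and recurrence: "\<And>i p. i \<ge> 1 \<Longrightarrow> p < k \<Longrightarrow>
      state_vec k u i $ p =
        c 0 p [] + (\<Sum>j = 1..m. \<Sum>ls \<in> tuples k j.
                      c j p ls * (\<Prod>s<j. state_vec k u (i - 1) $ (ls ! s)))"
    and ordered: "\<And>j p ls. 1 \<le> j \<Longrightarrow> j \<le> m \<Longrightarrow> p < k \<Longrightarrow> ls \<in> tuples k j \<Longrightarrow>
      \<not> sorted ls \<Longrightarrow> c j p ls = 0"
  defines "T \<equiv> carleman_mat k (coeff_mat k m c)"
  shows "row_finite T
    \<and> (\<forall>i. row_finite (inf_mat_power T i))
    \<and> (\<forall>i\<ge>1. carleman_vec k u i = inf_mat_vec T (carleman_vec k u (i - 1)))
    \<and> (\<forall>n i. 1 \<le> n \<and> n \<le> k \<longrightarrow>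
         u n i = inf_dot (inf_vec_mat (unit_row n) (inf_mat_power T i)) (carleman_vec k u 0))"
proof -
  let ?C = "coeff_mat k m c" and ?y = "carleman_vec k u" and ?z = "state_vec k u"
  have dim: "dim_vec (?z i) = k" for i by (simp add: state_vec_def)
  have C: "?C j \<in> carrier_mat k (k ^ j)" for j by (simp add: coeff_mat_def)
  have zero: "\<forall>j>m. ?C j = 0\<^sub>m k (k ^ j)" by (simp add: coeff_mat_def)
  have fin: "row_finite T"
    unfolding T_def by (rule row_finite_carleman_mat[OF assms(1) C zero])
  have z_Suc: "?z (Suc i) $ p = (\<Sum>j\<le>m. \<Sum>q<k ^ j. ?C j $$ (p, q) * kron_power (?z i) j $ q)"
    if p: "p < k" for i p
  proof -
    \<comment> \<open>The only tuple of length 0 is empty, so the constant term of the recurrence is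
      the \<open>j = 0\<close> term of the uniform sum.\<close>
    have 0: "tuples k 0 = {[]}" by (auto simp: tuples_def)
    have "(\<Sum>j\<le>m. \<Sum>q<k ^ j. ?C j $$ (p, q) * kron_power (?z i) j $ q)
        = (\<Sum>j\<le>m. \<Sum>ls\<in>tuples k j. c j p ls * (\<Prod>s<j. ?z i $ (ls ! s)))"
      using coeff_mat_kron_power[of _ m p "?z i" c] p dim by (intro sum.cong refl) simp
    also have "\<dots> = c 0 p [] + (\<Sum>j = 1..m. \<Sum>ls\<in>tuples k j. c j p ls * (\<Prod>s<j. ?z i $ (ls ! s)))"
      by (simp add: atMost_atLeast0 sum.atLeast_Suc_atMost 0)
    also have "\<dots> = ?z (Suc i) $ p" using recurrence[of "Suc i" p] p by simp
    finally show ?thesis by simp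
  qed
  have step: "?y (Suc i) = inf_mat_vec T (?y i)" for i
    using carleman_mat_kron_powers[of "?z i" ?C m "?z (Suc i)"] assms(1) C zero z_Suc
    by (simp add: dim T_def carleman_vec_def)
  have "u n i = inf_dot (inf_vec_mat (unit_row n) (inf_mat_power T i)) (?y 0)"
    if n: "1 \<le> n" "n \<le> k" for n i
  proof -
    \<comment> \<open>Block 0 occupies index 0 alone, so index \<open>n\<close> is position
      \<open>n - 1\<close> of block 1, which holds the state itself.\<close>
    have "?y i (block_start k 1 + (n - 1)) = kron_power (?z i) 1 $ (n - 1)"
      unfolding carleman_vec_def by (rule from_vec_blocks_nth) (use n in simp)
    moreover have "block_start k 1 + (n - 1) = n" using n by (simp add: block_start_def)
    moreover have "kron_power (?z i) 1 $ (n - 1) = u n i"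
      using n by (cases n) (simp_all add: state_vec_def)
    ultimately have "?y i n = u n i" by simp
    then show ?thesis by (simp only: inf_dot_unit_row inf_mat_vec_power[where y = ?y, OF fin step])
  qed
  moreover have "?y i = inf_mat_vec T (?y (i - 1))" if "i \<ge> 1" for i
    using step[of "i - 1"] that by simp
  ultimately show ?thesis using fin row_finite_power[OF fin] by blast
qed

end
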